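(* Let $n\in\mathbb{N}$, $N=n^2$, and let $P=\{p_1,\ldots,p_N\}\subset\mathbb{R}^2$ be a set of $N$ pairwise distinct points. Then there is a bijective placement $\pi:[N]\to[n]\times[n]$ of the points into the cells of an $n\times n$ grid such that the resulting grid $M_\pi(P)$ is in a stable state. Moreover, such a placement $\pi$ can be computed in $\mathcal{O}(N\log N)$ time.
   Context: Write $p=(p_1,p_2)$ for a point of $\mathbb{R}^2$ ($x$-value $p_1$, $y$-value $p_2$). An $n\times n$ grid has columns numbered $1,\ldots,n$ from left to right and rows numbered $1,\ldots,n$ from bottom to top; a bijective placement $\pi$ puts the point $p_i$ into the cell $\pi(i)$. Define the orders: $p\prec_x q$ iff $p_1<q_1$, or $p_1=q_1$ and $p_2<q_2$; and $p\prec_y q$ iff $p_2<q_2$, or $p_2=q_2$ and $p_1<q_1$. The grid is in a stable state iff (1) within every row, whenever a cell lies to the left of another cell, the point in the left cell is $\prec_x$-smaller than the point in the right cell, and (2) within every column, whenever a cell lies below another cell, the point in the lower cell is $\prec_y$-smaller than the point in the upper cell. *)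

theory Defs
  imports Complex_Main "HOL-Library.Landau_Symbols"
begin

type_synonym point = "real \<times> real"

text \<open>A cell is a pair (column, row), both numbered from 1; columns run from left to right,
  rows from bottom to top.\<close>

type_synonym cell = "nat \<times> nat"

definition less_x :: "point \<Rightarrow> point \<Rightarrow> bool" (infix "\<prec>\<^sub>x" 50) where
  "p \<prec>\<^sub>x q \<longleftrightarrow> fst p < fst q \<or> (fst p = fst q \<and> snd p < snd q)"

definition less_y :: "point \<Rightarrow> point \<Rightarrow> bool" (infix "\<prec>\<^sub>y" 50) where
  "p \<prec>\<^sub>y q \<longleftrightarrow> snd p < snd q \<or> (snd p = snd q \<and> fst p < fst q)"

text \<open>The grid sends each cell to the point placed there; it is meaningful on
  the \<open>n \<times> n\<close> cells if the placement is bijective.\<close>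

definition grid :: "nat \<Rightarrow> (nat \<Rightarrow> point) \<Rightarrow> (nat \<Rightarrow> cell) \<Rightarrow> cell \<Rightarrow> point" where
  "grid n p \<pi> = (\<lambda>c. p (the_inv_into {1..n^2} \<pi> c))"

definition stable_grid :: "nat \<Rightarrow> (cell \<Rightarrow> point) \<Rightarrow> bool" where
  "stable_grid n M \<longleftrightarrow>
     (\<forall>r\<in>{1..n}. \<forall>c\<in>{1..n}. \<forall>c'\<in>{1..n}. c < c' \<longrightarrow> M (c, r) \<prec>\<^sub>x M (c', r)) \<and>
     (\<forall>c\<in>{1..n}. \<forall>r\<in>{1..n}. \<forall>r'\<in>{1..n}. r < r' \<longrightarrow> M (c, r) \<prec>\<^sub>y M (c, r'))"

text \<open>Running time is measured on a unit-cost real RAM, programmed in a structured language.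
  There are scalar variables and randomly accessible arrays over the naturals and over the reals.
  The naturals, which serve as indices, have only addition and truncated subtraction at unit
  cost. The reals have exact field operations and comparisons. There is no rounding or other
  conversion from reals to naturals, and constants are rational, so a program is a finite object.
  Array and variable names occur literally in a program: each program uses finitely many.\<close>

record state =
  nvar :: "string \<Rightarrow> nat"
  narr :: "string \<Rightarrow> nat \<Rightarrow> nat"
  rvar :: "string \<Rightarrow> real"
  rarr :: "string \<Rightarrow> nat \<Rightarrow> real"

datatype nexp =
  NConst nat | NVar string | NRead string nexp | NAdd nexp nexp | NSub nexp nexp

datatype rexp =
  RConst rat | RVar string | RRead string nexp
| RAdd rexp rexp | RSub rexp rexp | RMul rexp rexp | RDiv rexp rexp

datatype bexp =
  NLess nexp nexp | RLess rexp rexp | BNot bexp | BAnd bexp bexp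

datatype com =
  Skip
| NAssign string nexp
| NWrite string nexp nexp
| RAssign string rexp
| RWrite string nexp rexp
| Seq com com
| If bexp com com
| While bexp com

primrec nval :: "nexp \<Rightarrow> state \<Rightarrow> nat" where
  "nval (NConst k) s = k"
| "nval (NVar x) s = nvar s x"
| "nval (NRead a e) s = narr s a (nval e s)"
| "nval (NAdd e f) s = nval e s + nval f s"
| "nval (NSub e f) s = nval e s - nval f s"

primrec rval :: "rexp \<Rightarrow> state \<Rightarrow> real" where
  "rval (RConst q) s = of_rat q"
| "rval (RVar x) s = rvar s x"
| "rval (RRead a e) s = rarr s a (nval e s)"
| "rval (RAdd e f) s = rval e s + rval f s"
| "rval (RSub e f) s = rval e s - rval f s"
| "rval (RMul e f) s = rval e s * rval f s"
| "rval (RDiv e f) s = rval e s / rval f s"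

primrec bval :: "bexp \<Rightarrow> state \<Rightarrow> bool" where
  "bval (NLess e f) s \<longleftrightarrow> nval e s < nval f s"
| "bval (RLess e f) s \<longleftrightarrow> rval e s < rval f s"
| "bval (BNot b) s \<longleftrightarrow> \<not> bval b s"
| "bval (BAnd b d) s \<longleftrightarrow> bval b s \<and> bval d s"

text \<open>Evaluating an expression costs one unit per constant, memory access, operation,
  comparison and connective in it.\<close>

primrec ncost :: "nexp \<Rightarrow> nat" where
  "ncost (NConst k) = 1"
| "ncost (NVar x) = 1"
| "ncost (NRead a e) = ncost e + 1"
| "ncost (NAdd e f) = ncost e + ncost f + 1"
| "ncost (NSub e f) = ncost e + ncost f + 1"

primrec rcost :: "rexp \<Rightarrow> nat" where
  "rcost (RConst q) = 1"
| "rcost (RVar x) = 1"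
| "rcost (RRead a e) = ncost e + 1"
| "rcost (RAdd e f) = rcost e + rcost f + 1"
| "rcost (RSub e f) = rcost e + rcost f + 1"
| "rcost (RMul e f) = rcost e + rcost f + 1"
| "rcost (RDiv e f) = rcost e + rcost f + 1"

primrec bcost :: "bexp \<Rightarrow> nat" where
  "bcost (NLess e f) = ncost e + ncost f + 1"
| "bcost (RLess e f) = rcost e + rcost f + 1"
| "bcost (BNot b) = bcost b + 1"
| "bcost (BAnd b d) = bcost b + bcost d + 1"

text \<open>\<open>exec c s t s'\<close>: started in state \<open>s\<close>, the program \<open>c\<close> terminates after \<open>t\<close> time units
  in state \<open>s'\<close>.\<close>

inductive exec :: "com \<Rightarrow> state \<Rightarrow> nat \<Rightarrow> state \<Rightarrow> bool" where
  Skip: "exec Skip s 1 s"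
| NAssign: "exec (NAssign x e) s (ncost e + 1) (s\<lparr>nvar := (nvar s)(x := nval e s)\<rparr>)"
| NWrite: "exec (NWrite a i e) s (ncost i + ncost e + 1)
    (s\<lparr>narr := (narr s)(a := (narr s a)(nval i s := nval e s))\<rparr>)"
| RAssign: "exec (RAssign x e) s (rcost e + 1) (s\<lparr>rvar := (rvar s)(x := rval e s)\<rparr>)"
| RWrite: "exec (RWrite a i e) s (ncost i + rcost e + 1)
    (s\<lparr>rarr := (rarr s)(a := (rarr s a)(nval i s := rval e s))\<rparr>)"
| Seq: "exec c s t s' \<Longrightarrow> exec d s' u s'' \<Longrightarrow> exec (Seq c d) s (t + u) s''"
| IfTrue: "bval b s \<Longrightarrow> exec c s t s' \<Longrightarrow> exec (If b c d) s (bcost b + t + 1) s'"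
| IfFalse: "\<not> bval b s \<Longrightarrow> exec d s t s' \<Longrightarrow> exec (If b c d) s (bcost b + t + 1) s'"
| WhileFalse: "\<not> bval b s \<Longrightarrow> exec (While b c) s (bcost b + 1) s"
| WhileTrue: "bval b s \<Longrightarrow> exec c s t s' \<Longrightarrow> exec (While b c) s' u s'' \<Longrightarrow>
    exec (While b c) s (bcost b + t + u + 1) s''"

lemma exec_deterministic:
  "exec c s t s' \<Longrightarrow> exec c s u s'' \<Longrightarrow> u = t \<and> s'' = s'"
proof (induction arbitrary: u s'' rule: exec.induct)
  case (Seq c s t s' d v s3)
  from Seq.prems show ?case
    by (cases rule: exec.cases) (use Seq.IH in \<open>blast+\<close>)
next
  case (IfTrue b s c t s' d)
  from IfTrue.prems IfTrue.hyps(1) show ?case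
    by (cases rule: exec.cases) (use IfTrue.IH in \<open>blast+\<close>)
next
  case (IfFalse b s d t s' c)
  from IfFalse.prems IfFalse.hyps(1) show ?case
    by (cases rule: exec.cases) (use IfFalse.IH in \<open>blast+\<close>)
next
  case (WhileFalse b s c)
  from WhileFalse.prems WhileFalse.hyps show ?case
    by (cases rule: exec.cases) simp_all
next
  case (WhileTrue b s c t s' v s3)
  from WhileTrue.prems WhileTrue.hyps(1) show ?case
    by (cases rule: exec.cases) (use WhileTrue.IH in \<open>blast+\<close>)
qed (erule exec.cases; simp)+

text \<open>The input is \<open>n\<close> and the coordinates of the points; all other memory is zero.\<close>

definition input_state :: "nat \<Rightarrow> (nat \<Rightarrow> point) \<Rightarrow> state" where
  "input_state n p = \<lparr>
     nvar = (\<lambda>_. 0)(''n'' := n),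
     narr = (\<lambda>_ _. 0),
     rvar = (\<lambda>_. 0),
     rarr = (\<lambda>_ _. 0)(
       ''x'' := (\<lambda>i. if i \<in> {1..n^2} then fst (p i) else 0),
       ''y'' := (\<lambda>i. if i \<in> {1..n^2} then snd (p i) else 0))\<rparr>"

definition output_placement :: "state \<Rightarrow> nat \<Rightarrow> cell" where
  "output_placement s = (\<lambda>i. (narr s ''column'' i, narr s ''row'' i))"

end

(* Sort the points by the x-order and let column c receive the c-th block of n consecutive points;
   within a column order the points by the y-order. Then every point of a column is x-smaller than
   every point of a column further to the right, so the rows are sorted for free.
   To obtain the rows, sort all points by the y-order and traverse them, keeping one counter per
   column. Both sorts are bottom-up merge sorts, which need neither division nor recursion. *)

theory Submission
  imports Defs
begin


subsection \<open>Running time of structured programs\<close>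

text \<open>The arrays being sorted hold point numbers; the coordinates stay in place and serve as
  keys, so one sort program with its two key arrays exchanged yields the other order. Distinctness
  of the points makes both lexicographic orders total on the point numbers, hence sortedness can be
  stated as strict monotonicity. Bijectivity is a matter of counting: distinct ranks within a column
  make the placement injective, and there are as many points as cells. Cost is proved together with
  correctness, because the number of iterations of a loop is known only through its invariant.
  Indices allow only addition and truncated subtraction, so \<open>n\<^sup>2\<close> is accumulated,
  division by \<open>n\<close> becomes a counter that wraps around, and the logarithm enters only as
  the number \<open>L\<close> of sorting rounds.\<close>

definition wp :: "com \<Rightarrow> (nat \<Rightarrow> state \<Rightarrow> bool) \<Rightarrow> state \<Rightarrow> bool" where
  "wp c Q s \<longleftrightarrow> (\<exists>t s'. exec c s t s' \<and> Q t s')"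

lemma wp_mono:
  assumes "wp c Q s" "\<And>t s'. Q t s' \<Longrightarrow> R t s'"
  shows "wp c R s"
  using assms unfolding wp_def by blast

text \<open>Determinism turns the existential in \<open>wp\<close> into a statement about the only
  run, so atomic commands rewrite \<open>wp\<close> to an equivalent condition.\<close>

lemma exec_wp: "exec c s t s' \<Longrightarrow> wp c Q s \<longleftrightarrow> Q t s'"
  unfolding wp_def by (metis exec_deterministic)

lemmas wp_atomic [simp] =
  exec_wp[OF exec.Skip] exec_wp[OF exec.NAssign] exec_wp[OF exec.NWrite]

lemma wp_Seq [simp]: "wp (Seq c d) Q s \<longleftrightarrow> wp c (\<lambda>t. wp d (\<lambda>u. Q (t + u))) s"
  unfolding wp_def by (blast elim: exec.cases intro: exec.intros)

lemma wp_If [simp]: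
  "wp (If b c d) Q s \<longleftrightarrow>
    (if bval b s then wp c (\<lambda>t. Q (bcost b + t + 1)) s else wp d (\<lambda>t. Q (bcost b + t + 1)) s)"
  unfolding wp_def
  by (smt (verit, best) com.distinct com.inject exec.IfTrue exec.IfFalse exec.cases)

text \<open>In \<open>I t s\<close>, the number \<open>t\<close> is the time budget left for the loop in state \<open>s\<close>; its decrease also
  yields termination.\<close>

lemma wp_While:
  assumes "I t s"
    and step: "\<And>t s. I t s \<Longrightarrow> bval b s \<Longrightarrow>
      wp c (\<lambda>u s'. \<exists>t'. I t' s' \<and> bcost b + u + t' + 1 \<le> t) s"
    and exit: "\<And>t s. I t s \<Longrightarrow> \<not> bval b s \<Longrightarrow> bcost b + 1 \<le> t"
  shows "wp (While b c) (\<lambda>u s'. u \<le> t \<and> \<not> bval b s' \<and> (\<exists>t'. I t' s')) s"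
  using assms(1)
\<comment> \<open>Every iteration pays at least 1 for the loop itself, so the remaining budget
  strictly decreases.\<close>
proof (induction t arbitrary: s rule: less_induct)
  case (less t)
  show ?case
  proof (cases "bval b s")
    case True
    from step[OF less.prems True] obtain u s' t' where
      u: "exec c s u s'" "I t' s'" "bcost b + u + t' + 1 \<le> t"
      unfolding wp_def by blast
    with less.IH[of t' s'] obtain v s'' where
      v: "exec (While b c) s' v s''" "v \<le> t'" "\<not> bval b s''" "\<exists>t'. I t' s''"
      unfolding wp_def by auto
    have "exec (While b c) s (bcost b + u + v + 1) s''"
      by (rule exec.WhileTrue[OF True u(1) v(1)])
    moreover have "bcost b + u + v + 1 \<le> t"
      using u(3) v(2) by linarith
    ultimately show ?thesis
      using v unfolding wp_def by blast
  next
    case False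
    with exit[OF less.prems] less.prems exec.WhileFalse[OF False] show ?thesis
      unfolding wp_def by blast
  qed
qed

subsection \<open>Merge sort\<close>

text \<open>\<open>f\<close> is the primary key and \<open>g\<close> breaks ties: with the
  coordinate arrays as keys this is \<prec>\<open>\<^sub>x\<close> on point numbers, with the arrays
  exchanged \<prec>\<open>\<^sub>y\<close>.\<close>

definition before :: "(nat \<Rightarrow> real) \<Rightarrow> (nat \<Rightarrow> real) \<Rightarrow> nat \<Rightarrow> nat \<Rightarrow> bool" where
  "before f g i j \<longleftrightarrow> f i < f j \<or> (f i = f j \<and> g i < g j)"

lemma transp_before: "transp (before f g)"
  by (auto simp: transp_def before_def)

text \<open>\<open>bexp\<close> has neither disjunction nor equality. The outer form is De Morgan;
  equality of the primary keys is weakened to "not greater", which is harmless because the strictly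
  smaller case already satisfies the first disjunct.\<close>

definition before_exp :: "string \<Rightarrow> string \<Rightarrow> nexp \<Rightarrow> nexp \<Rightarrow> bexp" where
  "before_exp f g d e =
    BNot (BAnd (BNot (RLess (RRead f d) (RRead f e)))
      (BNot (BAnd (BNot (RLess (RRead f e) (RRead f d))) (RLess (RRead g d) (RRead g e)))))"

lemma bval_before_exp [simp]:
  "bval (before_exp f g d e) s \<longleftrightarrow> before (rarr s f) (rarr s g) (nval d s) (nval e s)"
  by (auto simp: before_exp_def before_def)

lemma bcost_before_exp [simp]:
  "bcost (before_exp f g d e) = 3 * ncost d + 3 * ncost e + 15"
  by (simp add: before_exp_def)

section \<open>Merging two adjacent sorted runs\<close>

text \<open>The invariant of merging the runs \<open>{lo..<mid}\<close> and \<open>{mid..<hi}\<close> of \<open>A\<close>: the parts up to \<open>i\<close> and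
  \<open>j\<close> have been moved to \<open>B\<close>, below \<open>k\<close>.\<close>

definition merging :: "('a \<Rightarrow> 'a \<Rightarrow> bool) \<Rightarrow> (nat \<Rightarrow> 'a) \<Rightarrow> nat \<Rightarrow> nat \<Rightarrow> nat \<Rightarrow>
    (nat \<Rightarrow> 'a) \<Rightarrow> nat \<Rightarrow> nat \<Rightarrow> nat \<Rightarrow> bool" where
  "merging R A lo mid hi B i j k \<longleftrightarrow>
    lo \<le> i \<and> i \<le> mid \<and> mid \<le> j \<and> j \<le> hi \<and> k + mid = i + j \<and>
    B ` {lo..<k} = A ` ({lo..<i} \<union> {mid..<j}) \<and>
    monotone_on {lo..<k} (<) R B \<and>
    (\<forall>q\<in>{lo..<k}. \<forall>r\<in>{i..<mid} \<union> {j..<hi}. R (B q) (A r))"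

lemma monotone_on_snoc:
  assumes "monotone_on {lo..<k::nat} (<) R B" "\<forall>q\<in>{lo..<k}. R (B q) v"
  shows "monotone_on {lo..<Suc k} (<) R (B(k := v))"
  using assms by (auto simp: monotone_on_def less_Suc_eq)

lemma image_snoc:
  assumes "lo \<le> k"
  shows "(B(k := v)) ` {lo..<Suc k} = insert v (B ` {lo..<k})"
  using assms by (auto simp: atLeastLessThanSuc)

lemma monotone_on_leD:
  fixes i j :: nat
  assumes "monotone_on {lo..<hi} (<) R A" "lo \<le> i" "i \<le> j" "j < hi"
  shows "i = j \<or> R (A i) (A j)"
  using assms by (cases "i = j") (auto simp: monotone_on_def)

lemma merging_init:
  "lo \<le> mid \<Longrightarrow> mid \<le> hi \<Longrightarrow> merging R A lo mid hi B lo mid lo"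
  by (simp add: merging_def monotone_on_def)

text \<open>The head of the left run is below everything not yet moved: below the rest of its own
  run by monotonicity, below the right run by comparison with its head and transitivity. Hence
  appending it keeps \<open>B\<close> sorted and below the remainder. The premise \<open>le\<close>
  is conditional because the right run may be exhausted.\<close>

lemma merging_left:
  assumes M: "merging R A lo mid hi B i j k" and "i < mid"
    and R: "transp R" "monotone_on {lo..<mid} (<) R A" "monotone_on {mid..<hi} (<) R A"
    and le: "j < hi \<Longrightarrow> R (A i) (A j)"
  shows "merging R A lo mid hi (B(k := A i)) (Suc i) j (Suc k)"
proof -
  have *: "R (A i) (A r)" if "r \<in> {Suc i..<mid} \<union> {j..<hi}" for r
  proof (cases "r < mid")
    case True
    with that M R(2) show ?thesis
      by (auto simp: monotone_on_def merging_def)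
  next
    case False
    with that have r: "j \<le> r" "r < hi" by auto
    with M have "j = r \<or> R (A j) (A r)"
      using monotone_on_leD[OF R(3)] by (auto simp: merging_def)
    with r le R(1) show ?thesis
      by (auto dest: transpD)
  qed
  have k: "lo \<le> k" "lo \<le> i" "i \<le> mid" "mid \<le> j" using M by (auto simp: merging_def)
  have "(B(k := A i)) ` {lo..<Suc k} = A ` ({lo..<Suc i} \<union> {mid..<j})"
    using M k unfolding merging_def
    by (subst image_snoc) (auto simp only: atLeastLessThanSuc image_Un image_insert split: if_split)
  moreover have "monotone_on {lo..<Suc k} (<) R (B(k := A i))"
    using M \<open>i < mid\<close> k by (intro monotone_on_snoc) (auto simp: merging_def)
  moreover have "\<forall>q\<in>{lo..<Suc k}. \<forall>r\<in>{Suc i..<mid} \<union> {j..<hi}. R ((B(k := A i)) q) (A r)"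
    using M * by (auto simp: merging_def less_Suc_eq)
  ultimately show ?thesis
    using M \<open>i < mid\<close> by (auto simp: merging_def)
qed

text \<open>Mirror image of \<open>merging_left\<close>, with the left run possibly
  exhausted.\<close>

lemma merging_right:
  assumes M: "merging R A lo mid hi B i j k" and "j < hi"
    and R: "transp R" "monotone_on {lo..<mid} (<) R A" "monotone_on {mid..<hi} (<) R A"
    and le: "i < mid \<Longrightarrow> R (A j) (A i)"
  shows "merging R A lo mid hi (B(k := A j)) i (Suc j) (Suc k)"
proof -
  have *: "R (A j) (A r)" if "r \<in> {i..<mid} \<union> {Suc j..<hi}" for r
  proof (cases "r < mid")
    case True
    with that M have "i = r \<or> R (A i) (A r)" "i < mid"
      using monotone_on_leD[OF R(2)] by (auto simp: merging_def)
    with le R(1) show ?thesis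
      by (auto dest: transpD)
  next
    case False
    with that M R(3) show ?thesis
      by (auto simp: monotone_on_def merging_def)
  qed
  have k: "lo \<le> k" "lo \<le> i" "i \<le> mid" "mid \<le> j" using M by (auto simp: merging_def)
  have "(B(k := A j)) ` {lo..<Suc k} = A ` ({lo..<i} \<union> {mid..<Suc j})"
    using M k unfolding merging_def
    by (subst image_snoc) (auto simp only: atLeastLessThanSuc image_Un image_insert split: if_split)
  moreover have "monotone_on {lo..<Suc k} (<) R (B(k := A j))"
    using M \<open>j < hi\<close> k by (intro monotone_on_snoc) (auto simp: merging_def)
  moreover have "\<forall>q\<in>{lo..<Suc k}. \<forall>r\<in>{i..<mid} \<union> {Suc j..<hi}. R ((B(k := A j)) q) (A r)"
    using M * by (auto simp: merging_def less_Suc_eq)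
  ultimately show ?thesis
    using M \<open>j < hi\<close> by (auto simp: merging_def)
qed

text \<open>At \<open>k = hi\<close> the equation \<open>k + mid = i + j\<close> and the bounds on
  \<open>i\<close> and \<open>j\<close> leave only \<open>i = mid\<close> and \<open>j = hi\<close>:
  both runs are used up.\<close>

lemma merging_done:
  assumes "merging R A lo mid hi B i j hi"
  shows "B ` {lo..<hi} = A ` {lo..<hi}" "monotone_on {lo..<hi} (<) R B"
proof -
  have "i = mid" "j = hi" "{lo..<mid} \<union> {mid..<hi} = {lo..<hi}"
    using assms by (auto simp: merging_def)
  with assms show "B ` {lo..<hi} = A ` {lo..<hi}" "monotone_on {lo..<hi} (<) R B"
    by (simp_all add: merging_def)
qed

section \<open>The merge program and its cost\<close>

abbreviation V :: "string \<Rightarrow> nexp" where "V \<equiv> NVar"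

abbreviation incr :: "string \<Rightarrow> com" where "incr x \<equiv> NAssign x (NAdd (V x) (NConst 1))"

text \<open>\<open>BAnd\<close> always evaluates both sides, so the heads are compared even when a
  run is exhausted; arrays are total, and the bound tests discard the result.\<close>

definition merge_step :: "string \<Rightarrow> string \<Rightarrow> string \<Rightarrow> string \<Rightarrow> com" where
  "merge_step f g a b = Seq
    (If (BAnd (NLess (V ''i'') (V ''mid''))
          (BNot (BAnd (NLess (V ''j'') (V ''hi''))
            (before_exp f g (NRead a (V ''j'')) (NRead a (V ''i''))))))
      (Seq (NWrite b (V ''k'') (NRead a (V ''i''))) (incr ''i''))
      (Seq (NWrite b (V ''k'') (NRead a (V ''j''))) (incr ''j'')))
    (incr ''k'')"

definition merge :: "string \<Rightarrow> string \<Rightarrow> string \<Rightarrow> string \<Rightarrow> com" where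
  "merge f g a b = While (NLess (V ''k'') (V ''hi'')) (merge_step f g a b)"

text \<open>\<open>X\<close> and \<open>Y\<close> collect the index variables and index arrays that
  may change. The real arrays stay fixed since they are the sort keys: the order itself must not
  move during sorting.\<close>

definition frame :: "string set \<Rightarrow> string set \<Rightarrow> state \<Rightarrow> state \<Rightarrow> bool" where
  "frame X Y s s' \<longleftrightarrow> rarr s' = rarr s \<and> (\<forall>x. x \<notin> X \<longrightarrow> nvar s' x = nvar s x) \<and>
    (\<forall>a. a \<notin> Y \<longrightarrow> narr s' a = narr s a)"

lemma frame_refl: "frame X Y s s"
  by (simp add: frame_def)

lemma frame_trans: "frame X Y s s' \<Longrightarrow> frame X Y s' s'' \<Longrightarrow> frame X Y s s''"
  by (simp add: frame_def)

lemma frame_mono: "frame X Y s s' \<Longrightarrow> X \<subseteq> X' \<Longrightarrow> Y \<subseteq> Y' \<Longrightarrow> frame X' Y' s s'"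
  by (auto simp: frame_def)

text \<open>An iteration costs 53 units including the guard, rounded up to 60; the final 4 pays for
  the failing guard. The clause on positions below \<open>lo\<close> protects the blocks that a pass
  has already written.\<close>

lemma wp_merge:
  fixes s0 :: state and f g a b :: string
  defines "A \<equiv> narr s0 a" and "R \<equiv> before (rarr s0 f) (rarr s0 g)"
    and "lo \<equiv> nvar s0 ''lo''" and "mid \<equiv> nvar s0 ''mid''" and "hi \<equiv> nvar s0 ''hi''"
  assumes "a \<noteq> b" and ijk: "nvar s0 ''i'' = lo" "nvar s0 ''j'' = mid" "nvar s0 ''k'' = lo"
    and "lo \<le> mid" "mid \<le> hi"
    and mono: "monotone_on {lo..<mid} (<) R A" "monotone_on {mid..<hi} (<) R A"
    and total: "totalp_on (A ` {lo..<hi}) R" and inj: "inj_on A {lo..<hi}"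
  shows "wp (merge f g a b) (\<lambda>t s. t \<le> 60 * (hi - lo) + 4 \<and>
    narr s b ` {lo..<hi} = A ` {lo..<hi} \<and> monotone_on {lo..<hi} (<) R (narr s b) \<and>
    (\<forall>q. q < lo \<longrightarrow> narr s b q = narr s0 b q) \<and> frame {''i'', ''j'', ''k''} {b} s0 s) s0"
proof -
  define I where "I t s \<longleftrightarrow> t = 60 * (hi - nvar s ''k'') + 4 \<and>
    merging R A lo mid hi (narr s b) (nvar s ''i'') (nvar s ''j'') (nvar s ''k'') \<and>
    (\<forall>q. q < lo \<longrightarrow> narr s b q = narr s0 b q) \<and> frame {''i'', ''j'', ''k''} {b} s0 s" for t s
  have "wp (merge f g a b) (\<lambda>u s'. u \<le> 60 * (hi - lo) + 4 \<and>
    \<not> bval (NLess (V ''k'') (V ''hi'')) s' \<and> (\<exists>t'. I t' s')) s0"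
    unfolding merge_def
  proof (rule wp_While)
    show "I (60 * (hi - lo) + 4) s0"
      using ijk \<open>lo \<le> mid\<close> \<open>mid \<le> hi\<close> by (simp add: I_def merging_init frame_refl)
  next
    fix t s assume I: "I t s" and "bval (NLess (V ''k'') (V ''hi'')) s"
    moreover from I have F: "narr s a = A" "rarr s = rarr s0" "nvar s ''mid'' = mid"
      "nvar s ''hi'' = hi" "nvar s ''lo'' = lo"
      using \<open>a \<noteq> b\<close> by (auto simp: I_def A_def mid_def hi_def lo_def frame_def)
    ultimately have k: "nvar s ''k'' < hi" by simp
    let ?i = "nvar s ''i''" and ?j = "nvar s ''j''" and ?k = "nvar s ''k''" and ?B = "narr s b"
    have M: "merging R A lo mid hi ?B ?i ?j ?k" using I by (simp add: I_def)
    then have le: "lo \<le> ?i" "?i \<le> mid" "mid \<le> ?j" "?j \<le> hi" "?k + mid = ?i + ?j"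
      by (auto simp: merging_def)
    then have "lo \<le> ?k" by linarith
    \<comment> \<open>Totality speaks only of distinct elements; injectivity of \<open>A\<close>
      makes the two heads distinct.\<close>
    have total': "R (A ?i) (A ?j) \<or> R (A ?j) (A ?i)" if "?i < mid" "?j < hi"
    proof -
      have "A ?i \<noteq> A ?j" using inj_onD[OF inj, of ?i ?j] that le by auto
      then show ?thesis using total that le by (auto simp: totalp_on_def)
    qed
    have R: "transp R" by (simp add: R_def transp_before)
    have bR: "before (rarr s0 f) (rarr s0 g) = R" by (simp add: R_def)
    have budget: "60 * (hi - ?k) = 60 * (hi - Suc ?k) + 60" using k by simp
    show "wp (merge_step f g a b) (\<lambda>u s'. \<exists>t'. I t' s' \<and>
       bcost (NLess (V ''k'') (V ''hi'')) + u + t' + 1 \<le> t) s"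
    proof (cases "?i < mid \<and> \<not> (?j < hi \<and> R (A ?j) (A ?i))")
      case True
      then have "merging R A lo mid hi (?B(?k := A ?i)) (Suc ?i) ?j (Suc ?k)"
        using total' by (intro merging_left M R mono) auto
      then show ?thesis
        using True I k \<open>lo \<le> ?k\<close> \<open>a \<noteq> b\<close>
        by (simp add: merge_step_def I_def F bR budget frame_def)
    next
      case False
      then have "merging R A lo mid hi (?B(?k := A ?j)) ?i (Suc ?j) (Suc ?k)"
        using k le by (intro merging_right M R mono) auto
      then show ?thesis
        using False I k \<open>lo \<le> ?k\<close> \<open>a \<noteq> b\<close>
        by (auto simp: merge_step_def I_def F bR budget frame_def)
    qed
  qed (simp add: I_def)
  then show ?thesis
  proof (rule wp_mono, elim conjE exE)
    fix t s t'
    assume *: "I t' s" "t \<le> 60 * (hi - lo) + 4" "\<not> bval (NLess (V ''k'') (V ''hi'')) s"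
    then have "nvar s ''k'' = hi"
      by (auto simp: I_def frame_def merging_def hi_def)
    with * show "t \<le> 60 * (hi - lo) + 4 \<and>
    narr s b ` {lo..<hi} = A ` {lo..<hi} \<and> monotone_on {lo..<hi} (<) R (narr s b) \<and>
    (\<forall>q. q < lo \<longrightarrow> narr s b q = narr s0 b q) \<and> frame {''i'', ''j'', ''k''} {b} s0 s"
      using merging_done unfolding I_def by metis
  qed
qed

section \<open>Passes over aligned sorted blocks\<close>

definition sorted_blocks :: "('a \<Rightarrow> 'a \<Rightarrow> bool) \<Rightarrow> nat \<Rightarrow> nat \<Rightarrow> (nat \<Rightarrow> 'a) \<Rightarrow> bool" where
  "sorted_blocks R w N A \<longleftrightarrow> (\<forall>m. monotone_on {m * w..<min N (m * w + w)} (<) R A)"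

lemma sorted_blocks_1: "sorted_blocks R 1 N A"
  by (auto simp: sorted_blocks_def monotone_on_def)

lemma sorted_blocks_large:
  assumes "sorted_blocks R w N A" "N \<le> w"
  shows "monotone_on {..<N} (<) R A"
  using assms(1)[unfolded sorted_blocks_def, rule_format, of 0] assms(2)
  by (simp add: min_absorb1 lessThan_atLeast0)

text \<open>The length argument of \<open>sorted_blocks\<close> serves as a write frontier moving
  from \<open>lo\<close> to \<open>hi\<close>. Blocks before number \<open>m\<close> lie in the
  unchanged prefix, block \<open>m\<close> is the new piece, and later blocks are empty because they
  start at or beyond \<open>hi\<close>.\<close>

lemma sorted_blocks_extend:
  assumes B: "sorted_blocks R w lo B" and lo: "lo = m * w" and "hi \<le> lo + w"
    and B': "monotone_on {lo..<hi} (<) R B'" "\<forall>q<lo. B' q = B q"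
  shows "sorted_blocks R w hi B'"
  unfolding sorted_blocks_def
proof
  fix l
  consider "l < m" | "l = m" | "m < l" by linarith
  then show "monotone_on {l * w..<min hi (l * w + w)} (<) R B'"
  proof cases
    case 1
    then have "Suc l * w \<le> m * w" by (intro mult_le_mono1) simp
    then have "min lo (l * w + w) = l * w + w" "l * w + w \<le> lo" by (simp_all add: lo)
    moreover have "monotone_on {l * w..<min lo (l * w + w)} (<) R B"
      using B by (simp add: sorted_blocks_def)
    ultimately show ?thesis
      using B'(2) by (auto simp: monotone_on_def)
  next
    case 2
    with \<open>hi \<le> lo + w\<close> B'(1) show ?thesis by (simp add: lo min_absorb1)
  next
    case 3
    then have "Suc m * w \<le> l * w" by (intro mult_le_mono1) simp
    with \<open>hi \<le> lo + w\<close> show ?thesis by (simp add: lo monotone_on_def)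
  qed
qed

text \<open>Truncated subtraction computes a minimum without branching; it clips the block
  boundaries at the end of the array.\<close>

abbreviation NMin :: "nexp \<Rightarrow> nexp \<Rightarrow> nexp" where "NMin d e \<equiv> NSub d (NSub d e)"

lemma diff_diff_min: "d - (d - e) = min d (e::nat)"
  by simp

definition merge_pass :: "string \<Rightarrow> string \<Rightarrow> string \<Rightarrow> string \<Rightarrow> com" where
  "merge_pass f g a b = Seq (NAssign ''lo'' (NConst 0)) (While (NLess (V ''lo'') (V ''N''))
    (Seq (NAssign ''mid'' (NMin (NAdd (V ''lo'') (V ''w'')) (V ''N'')))
    (Seq (NAssign ''hi'' (NMin (NAdd (V ''mid'') (V ''w'')) (V ''N'')))
    (Seq (NAssign ''i'' (V ''lo''))
    (Seq (NAssign ''j'' (V ''mid''))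
    (Seq (NAssign ''k'' (V ''lo''))
    (Seq (merge f g a b)
    (NAssign ''lo'' (V ''hi'')))))))))"

definition merge_vars :: "string set" where
  "merge_vars = {''lo'', ''mid'', ''hi'', ''i'', ''j'', ''k''}"

text \<open>Block \<open>m\<close> of width \<open>2 * w\<close> arises from the input blocks
  \<open>2 * m\<close> and \<open>2 * m + 1\<close>. As \<open>0 < w\<close>, each merged piece is
  nonempty, so its constant overhead is absorbed by doubling the 60 units per element to
  120.\<close>

lemma wp_merge_pass:
  fixes s0 :: state and f g a b :: string
  defines "A \<equiv> narr s0 a" and "R \<equiv> before (rarr s0 f) (rarr s0 g)"
    and "N \<equiv> nvar s0 ''N''" and "w \<equiv> nvar s0 ''w''"
  assumes "a \<noteq> b" and "0 < w" and blocks: "sorted_blocks R w N A"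
    and total: "totalp_on (A ` {..<N}) R" and inj: "inj_on A {..<N}"
  shows "wp (merge_pass f g a b) (\<lambda>t s. t \<le> 120 * N + 10 \<and>
    narr s b ` {..<N} = A ` {..<N} \<and> sorted_blocks R (2 * w) N (narr s b) \<and>
    frame merge_vars {b} s0 s) s0"
proof -
  define I where "I t s \<longleftrightarrow> t = 120 * (N - nvar s ''lo'') + 4 \<and>
    (\<exists>m. nvar s ''lo'' = min N (m * (2 * w))) \<and>
    narr s b ` {..<nvar s ''lo''} = A ` {..<nvar s ''lo''} \<and>
    sorted_blocks R (2 * w) (nvar s ''lo'') (narr s b) \<and> frame merge_vars {b} s0 s" for t s
  show ?thesis
    unfolding merge_pass_def wp_Seq wp_atomic
  proof (rule wp_mono, rule wp_While)
    show "I (120 * N + 4) (s0\<lparr>nvar := (nvar s0)(''lo'' := nval (NConst 0) s0)\<rparr>)"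
      by (auto simp: I_def sorted_blocks_def monotone_on_def frame_def merge_vars_def
          intro: exI[of _ 0])
  next
    fix t s assume I: "I t s" and "bval (NLess (V ''lo'') (V ''N'')) s"
    moreover from I have F: "narr s a = A" "rarr s = rarr s0" "nvar s ''N'' = N"
      "nvar s ''w'' = w"
      using \<open>a \<noteq> b\<close> by (auto simp: I_def A_def w_def N_def merge_vars_def frame_def)
    ultimately have lo_less: "nvar s ''lo'' < N" by simp
    define lo mid hi where "lo = nvar s ''lo''" and "mid = min (lo + w) N"
      and "hi = min (mid + w) N"
    from I lo_less obtain m where m: "lo = m * (2 * w)" "lo < N"
      by (auto simp: I_def lo_def min_def split: if_splits)
    have hi: "hi = min (lo + 2 * w) N" "lo < hi" "hi \<le> N" "lo \<le> mid" "mid \<le> hi"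
      using m \<open>0 < w\<close> by (auto simp: hi_def mid_def min_def)
    have left: "monotone_on {lo..<mid} (<) R A"
      using blocks[unfolded sorted_blocks_def, rule_format, of "2 * m"]
      by (simp add: m mid_def mult_ac min.commute)
    \<comment> \<open>If \<open>lo + w\<close> reaches \<open>N\<close>, the right run is empty and
      the merge just copies the left one.\<close>
    have right: "monotone_on {mid..<hi} (<) R A"
    proof (cases "lo + w < N")
      case True
      then show ?thesis
        using blocks[unfolded sorted_blocks_def, rule_format, of "2 * m + 1"]
        by (simp add: m mid_def hi_def algebra_simps min.commute min_absorb1)
    qed (auto simp: monotone_on_def mid_def hi_def min_def)
    have sub: "{lo..<hi} \<subseteq> {..<N}" using hi by auto
    define s1 where "s1 = s\<lparr>nvar := (nvar s)(''mid'' := mid, ''hi'' := hi, ''i'' := lo,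
      ''j'' := mid, ''k'' := lo)\<rparr>"
    define Q where "Q = (\<lambda>u s'. u \<le> 60 * (hi - lo) + 4 \<and>
      narr s' b ` {lo..<hi} = A ` {lo..<hi} \<and> monotone_on {lo..<hi} (<) R (narr s' b) \<and>
      (\<forall>q. q < lo \<longrightarrow> narr s' b q = narr s1 b q) \<and> frame {''i'', ''j'', ''k''} {b} s1 s')"
    have s1: "nvar s1 ''lo'' = lo" "nvar s1 ''mid'' = mid" "nvar s1 ''hi'' = hi"
      "nvar s1 ''i'' = lo" "nvar s1 ''j'' = mid" "nvar s1 ''k'' = lo"
      "narr s1 a = A" "rarr s1 = rarr s0" "narr s1 b = narr s b"
      by (simp_all add: s1_def F lo_def)
    have W: "wp (merge f g a b) Q s1"
      unfolding Q_def
      by (rule wp_merge[of a b s1 f g, unfolded s1(1-8), folded R_def, OF \<open>a \<noteq> b\<close> refl refl refl])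
         (rule hi left right totalp_on_subset[OF total image_mono[OF sub]] inj_on_subset[OF inj sub])+
    have old: "narr s b ` {..<lo} = A ` {..<lo}" "sorted_blocks R (2 * w) lo (narr s b)"
      "frame merge_vars {b} s0 s" "t = 120 * (N - lo) + 4"
      using I by (simp_all add: I_def lo_def)
    have next_lo: "\<exists>t'. I t' (s'\<lparr>nvar := (nvar s')(''lo'' := nvar s' ''hi'')\<rparr>) \<and> u + t' + 40 \<le> t"
      if Q: "Q u s'" for u s'
    proof -
      have fr: "frame {''i'', ''j'', ''k''} {b} s1 s'" using Q by (simp add: Q_def)
      have hi': "nvar s' ''hi'' = hi" using fr by (simp add: frame_def s1_def)
      have "{..<hi} = {..<lo} \<union> {lo..<hi}" using hi(2) by auto
      moreover have "narr s' b ` {..<lo} = narr s b ` {..<lo}"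
        using Q by (intro image_cong) (simp_all add: s1 Q_def)
      ultimately have "narr s' b ` {..<hi} = A ` {..<hi}"
        using old(1) Q by (simp add: Q_def image_Un)
      moreover have "sorted_blocks R (2 * w) hi (narr s' b)"
        using Q hi(1) by (intro sorted_blocks_extend[OF old(2) m(1)]) (simp_all add: Q_def s1)
      moreover have "hi = min N (Suc m * (2 * w))"
        using hi(1) m(1) by (simp add: min.commute)
      then have "\<exists>m. hi = min N (m * (2 * w))" by blast
      moreover have "frame merge_vars {b} s0 (s'\<lparr>nvar := (nvar s')(''lo'' := hi)\<rparr>)"
        using old(3) fr by (simp add: frame_def s1_def merge_vars_def)
      ultimately have "I (120 * (N - hi) + 4) (s'\<lparr>nvar := (nvar s')(''lo'' := nvar s' ''hi'')\<rparr>)"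
        by (simp add: I_def hi')
      \<comment> \<open>The 40 covers the guard and the six assignments around the merge, which cost
        32 in all.\<close>
      moreover have "u + (120 * (N - hi) + 4) + 40 \<le> t"
      proof -
        have "u \<le> 60 * (hi - lo) + 4" using Q by (simp add: Q_def)
        with hi(2,3) old(4) show ?thesis by linarith
      qed
      ultimately show ?thesis by blast
    qed
    show "wp (Seq (NAssign ''mid'' (NMin (NAdd (V ''lo'') (V ''w'')) (V ''N'')))
      (Seq (NAssign ''hi'' (NMin (NAdd (V ''mid'') (V ''w'')) (V ''N'')))
      (Seq (NAssign ''i'' (V ''lo''))
      (Seq (NAssign ''j'' (V ''mid''))
      (Seq (NAssign ''k'' (V ''lo''))
      (Seq (merge f g a b)
      (NAssign ''lo'' (V ''hi''))))))))
      (\<lambda>u s'. \<exists>t'. I t' s' \<and> bcost (NLess (V ''lo'') (V ''N'')) + u + t' + 1 \<le> t) s"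
      apply (simp add: F lo_def[symmetric] diff_diff_min mid_def[symmetric] hi_def[symmetric]
        s1_def[symmetric] del: diff_diff_cancel)
      apply (rule wp_mono[OF W])
      apply (drule next_lo)
      apply auto
      done
  next
    fix t s assume *: "t \<le> 120 * N + 4 \<and> \<not> bval (NLess (V ''lo'') (V ''N'')) s \<and> (\<exists>t'. I t' s)"
    then have "nvar s ''N'' = N" by (auto simp: I_def frame_def N_def merge_vars_def)
    with * have "nvar s ''lo'' = N" by (auto simp: I_def)
    with * show "ncost (NConst 0) + 1 + t \<le> 120 * N + 10 \<and> narr s b ` {..<N} = A ` {..<N} \<and>
      sorted_blocks R (2 * w) N (narr s b) \<and> frame merge_vars {b} s0 s"
      by (auto simp: I_def)
  qed (simp add: I_def)
qed

text \<open>A round consists of a pass from \<open>a\<close> to \<open>b\<close> and one back, so that no copying is needed; it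
  multiplies the width of the sorted blocks by 4.\<close>

definition merge_sort :: "string \<Rightarrow> string \<Rightarrow> string \<Rightarrow> string \<Rightarrow> com" where
  "merge_sort f g a b = Seq (NAssign ''w'' (NConst 1)) (While (NLess (V ''w'') (V ''N''))
    (Seq (merge_pass f g a b)
    (Seq (NAssign ''w'' (NAdd (V ''w'') (V ''w'')))
    (Seq (merge_pass f g b a)
    (NAssign ''w'' (NAdd (V ''w'') (V ''w'')))))))"

text \<open>Merging records only which values occur. On a finite set, equally many values force
  injectivity, so each pass again receives an array without repetitions.\<close>

lemma inj_on_if_image_eq:
  assumes "inj_on A S" "finite S" "B ` S = A ` S"
  shows "inj_on B S"
  using assms by (metis card_image eq_card_imp_inj_on)

text \<open>After \<open>j\<close> rounds the width is \<open>4 ^ j\<close>, so at most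
  \<open>L\<close> rounds run. A round is two passes of \<open>120 * N + 10\<close> each, plus 12
  units for the guard and the two doublings of the width; 50 generously covers the
  constants.\<close>

lemma wp_merge_sort:
  fixes s0 :: state and f g a b :: string
  defines "A \<equiv> narr s0 a" and "R \<equiv> before (rarr s0 f) (rarr s0 g)" and "N \<equiv> nvar s0 ''N''"
  assumes "a \<noteq> b" and total: "totalp_on (A ` {..<N}) R" and inj: "inj_on A {..<N}"
    and L: "N \<le> 4 ^ L"
  shows "wp (merge_sort f g a b) (\<lambda>t s. t \<le> (240 * N + 50) * L + 6 \<and>
    narr s a ` {..<N} = A ` {..<N} \<and> monotone_on {..<N} (<) R (narr s a) \<and>
    frame (insert ''w'' merge_vars) {a, b} s0 s) s0"
proof -
  define I where "I t s \<longleftrightarrow> (\<exists>j\<le>L. t = (240 * N + 50) * (L - j) + 4 \<and> nvar s ''w'' = 4 ^ j) \<and>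
    narr s a ` {..<N} = A ` {..<N} \<and> sorted_blocks R (nvar s ''w'') N (narr s a) \<and>
    frame (insert ''w'' merge_vars) {a, b} s0 s" for t s
  have N: "nvar s ''N'' = N" if "frame (insert ''w'' merge_vars) {a, b} s0 s" for s
    using that by (simp add: frame_def N_def merge_vars_def)
  show ?thesis
    unfolding merge_sort_def wp_Seq wp_atomic
  proof (rule wp_mono, rule wp_While)
    show "I ((240 * N + 50) * L + 4) (s0\<lparr>nvar := (nvar s0)(''w'' := nval (NConst 1) s0)\<rparr>)"
      using sorted_blocks_1
      by (auto simp: I_def frame_def A_def intro!: exI[of _ 0])
  next
    fix t s assume I: "I t s" and "bval (NLess (V ''w'') (V ''N'')) s"
    then have less: "nvar s ''w'' < N" using N by (simp add: I_def)
    from I obtain j where j: "j \<le> L" "t = (240 * N + 50) * (L - j) + 4" "nvar s ''w'' = 4 ^ j"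
      by (auto simp: I_def)
    have "j \<noteq> L" using less j(3) L by auto
    with j(1) have "L - j = Suc (L - Suc j)" "Suc j \<le> L" by simp_all
    with j(2) have t: "t = (240 * N + 50) * (L - Suc j) + 4 + (240 * N + 50)" by simp
    have fr: "frame (insert ''w'' merge_vars) {a, b} s0 s"
      and im: "narr s a ` {..<N} = A ` {..<N}" and sb: "sorted_blocks R (4 ^ j) N (narr s a)"
      using I j(3) by (simp_all add: I_def)
    have R: "before (rarr s' f) (rarr s' g) = R"
      if "frame (insert ''w'' merge_vars) {a, b} s0 s'" for s'
      using that by (simp add: frame_def R_def)
    define w where "w = nvar s ''w''"
    define Q1 where "Q1 = (\<lambda>u s'. u \<le> 120 * N + 10 \<and> narr s' b ` {..<N} = A ` {..<N} \<and>
      sorted_blocks R (2 * w) N (narr s' b) \<and> frame merge_vars {b} s s')"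
    have W1: "wp (merge_pass f g a b) Q1 s"
      using wp_merge_pass[of a b s f g] \<open>a \<noteq> b\<close> total sb j(3) inj_on_if_image_eq[OF inj _ im]
      by (simp add: Q1_def N[OF fr] R[OF fr] im w_def)
    define Q2 where "Q2 = (\<lambda>u s'. u \<le> 120 * N + 10 \<and> narr s' a ` {..<N} = A ` {..<N} \<and>
      sorted_blocks R (2 * (2 * w)) N (narr s' a) \<and>
      frame (insert ''w'' merge_vars) {a, b} s0 s' \<and> nvar s' ''w'' = 2 * w)"
    have W2: "wp (merge_pass f g b a) Q2 (s'\<lparr>nvar := (nvar s')(''w'' := w + w)\<rparr>)"
      if Q1: "Q1 u s'" for u s'
    proof -
      let ?s = "s'\<lparr>nvar := (nvar s')(''w'' := w + w)\<rparr>"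
      have fr': "frame (insert ''w'' merge_vars) {a, b} s0 ?s"
        using fr Q1 by (simp add: Q1_def frame_def)
      have im': "narr s' b ` {..<N} = A ` {..<N}" using Q1 by (simp add: Q1_def)
      have "wp (merge_pass f g b a) (\<lambda>u s'. u \<le> 120 * N + 10 \<and> narr s' a ` {..<N} = A ` {..<N} \<and>
          sorted_blocks R (2 * (2 * w)) N (narr s' a) \<and> frame merge_vars {a} ?s s') ?s"
        using wp_merge_pass[of b a ?s f g, unfolded N[OF fr'] R[OF fr']] Q1 \<open>a \<noteq> b\<close> total j(3)
          inj_on_if_image_eq[OF inj _ im']
        by (simp add: Q1_def w_def mult_2[symmetric])
      then show ?thesis
      proof (rule wp_mono)
        fix u s''
        assume *: "u \<le> 120 * N + 10 \<and> narr s'' a ` {..<N} = A ` {..<N} \<and>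
          sorted_blocks R (2 * (2 * w)) N (narr s'' a) \<and> frame merge_vars {a} ?s s''"
        then have "frame (insert ''w'' merge_vars) {a, b} ?s s''"
          by (blast intro: frame_mono)
        with fr' have "frame (insert ''w'' merge_vars) {a, b} s0 s''"
          by (rule frame_trans)
        moreover have "nvar s'' ''w'' = 2 * w"
          using * by (simp add: frame_def merge_vars_def)
        ultimately show "Q2 u s''" using * by (simp add: Q2_def)
      qed
    qed
    have w1: "nvar s' ''w'' = w" if "Q1 u s'" for u s'
      using that by (simp add: Q1_def frame_def w_def merge_vars_def)
    have next_I: "\<exists>t'. I t' (s''\<lparr>nvar := (nvar s'')(''w'' := nvar s'' ''w'' + nvar s'' ''w'')\<rparr>) \<and>
        u + v + t' + 20 \<le> t" if Q: "Q1 u s'" "Q2 v s''" for u s' v s''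
    proof -
      have "I ((240 * N + 50) * (L - Suc j) + 4)
          (s''\<lparr>nvar := (nvar s'')(''w'' := nvar s'' ''w'' + nvar s'' ''w'')\<rparr>)"
        using Q(2) \<open>Suc j \<le> L\<close>
        by (auto simp: I_def Q2_def w_def j(3) frame_def intro!: exI[of _ "Suc j"])
      moreover have "u + v + ((240 * N + 50) * (L - Suc j) + 4) + 20 \<le> t"
        using Q by (simp add: Q1_def Q2_def t)
      ultimately show ?thesis by blast
    qed
    show "wp (Seq (merge_pass f g a b)
      (Seq (NAssign ''w'' (NAdd (V ''w'') (V ''w'')))
      (Seq (merge_pass f g b a)
      (NAssign ''w'' (NAdd (V ''w'') (V ''w''))))))
      (\<lambda>u s'. \<exists>t'. I t' s' \<and> bcost (NLess (V ''w'') (V ''N'')) + u + t' + 1 \<le> t) s"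
      apply simp
      apply (rule wp_mono[OF W1])
      apply (frule w1)
      apply simp
      apply (rule wp_mono[OF W2], assumption)
      apply (drule (1) next_I)
      apply auto
      done
  next
    fix t s assume *: "t \<le> (240 * N + 50) * L + 4 \<and> \<not> bval (NLess (V ''w'') (V ''N'')) s \<and>
      (\<exists>t'. I t' s)"
    then have "N \<le> nvar s ''w''" using N by (auto simp: I_def)
    with * show "ncost (NConst 1) + 1 + t \<le> (240 * N + 50) * L + 6 \<and>
      narr s a ` {..<N} = A ` {..<N} \<and> monotone_on {..<N} (<) R (narr s a) \<and>
      frame (insert ''w'' merge_vars) {a, b} s0 s"
      using sorted_blocks_large by (fastforce simp: I_def)
  qed (auto simp: I_def)
qed

text \<open>Common rule for the linear loops: \<open>C\<close> bounds the body, each guard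
  evaluation adds 4, and the last 4 is the failing guard. The invariant \<open>J\<close> also pins
  the loop bound \<open>x\<close>, so the body cannot move it.\<close>

lemma wp_count_up:
  assumes "J 0 s0"
    and vars: "\<And>k s. J k s \<Longrightarrow> nvar s ''k'' = k \<and> nvar s x = M"
    and step: "\<And>k s. J k s \<Longrightarrow> k < M \<Longrightarrow> wp c (\<lambda>u s'. u \<le> C \<and> J (Suc k) s') s"
  shows "wp (While (NLess (V ''k'') (V x)) c) (\<lambda>u s'. u \<le> (C + 4) * M + 4 \<and> J M s') s0"
proof -
  define I where "I t s \<longleftrightarrow> (\<exists>k\<le>M. J k s \<and> t = (C + 4) * (M - k) + 4)" for t s
  show ?thesis
  proof (rule wp_mono, rule wp_While)
    show "I ((C + 4) * M + 4) s0" using assms(1) by (auto simp: I_def intro!: exI[of _ 0])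
  next
    fix t s assume "I t s" and b: "bval (NLess (V ''k'') (V x)) s"
    then obtain k where k: "k \<le> M" "J k s" "t = (C + 4) * (M - k) + 4"
      by (auto simp: I_def)
    with b vars[OF k(2)] have "k < M" by simp
    then have "M - k = Suc (M - Suc k)" by simp
    with k(3) have t: "t = (C + 4) * (M - Suc k) + 4 + (C + 4)" by simp
    show "wp c (\<lambda>u s'. \<exists>t'. I t' s' \<and> bcost (NLess (V ''k'') (V x)) + u + t' + 1 \<le> t) s"
      using step[OF k(2) \<open>k < M\<close>]
    proof (rule wp_mono)
      fix u s' assume u: "u \<le> C \<and> J (Suc k) s'"
      then have "I ((C + 4) * (M - Suc k) + 4) s'"
        using \<open>k < M\<close> unfolding I_def by (intro exI[of _ "Suc k"]) simp
      with u show "\<exists>t'. I t' s' \<and> bcost (NLess (V ''k'') (V x)) + u + t' + 1 \<le> t"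
        by (intro exI[of _ "(C + 4) * (M - Suc k) + 4"]) (simp add: t)
    qed
  next
    fix t s assume *: "t \<le> (C + 4) * M + 4 \<and> \<not> bval (NLess (V ''k'') (V x)) s \<and> (\<exists>t'. I t' s)"
    then obtain k where "k \<le> M" "J k s" by (auto simp: I_def)
    moreover from this * vars[of k s] have "k = M" by simp
    ultimately show "t \<le> (C + 4) * M + 4 \<and> J M s" using * by simp
  qed (auto simp: I_def)
qed

subsection \<open>Stable placements from sorted orders\<close>

text \<open>The y-rank inside a column separates its points, so \<open>pos\<close> is injective.
  Columns of size at most \<open>n\<close> keep the ranks within \<open>{1..n}\<close>, and an
  injection of \<open>n\<^sup>2\<close> points into \<open>n\<^sup>2\<close> cells is onto; that
  each column is full is a consequence. The disjunct \<open>j = i\<close> makes ranks start at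
  1.\<close>

lemma rank_placement:
  fixes n :: nat and p :: "nat \<Rightarrow> point" and col row :: "nat \<Rightarrow> nat"
  defines "D \<equiv> {1..n\<^sup>2}" and "pos \<equiv> (\<lambda>i. (col i, row i))"
  assumes p: "inj_on p D"
    and col: "\<And>i. i \<in> D \<Longrightarrow> col i \<in> {1..n}"
    and card_col: "\<And>c. c \<in> {1..n} \<Longrightarrow> card {i \<in> D. col i = c} \<le> n"
    and less_col: "\<And>i j. i \<in> D \<Longrightarrow> j \<in> D \<Longrightarrow> col i < col j \<Longrightarrow> p i \<prec>\<^sub>x p j"
    and row: "\<And>i. i \<in> D \<Longrightarrow> row i = card {j \<in> D. col j = col i \<and> (j = i \<or> p j \<prec>\<^sub>y p i)}"
  shows "bij_betw pos D ({1..n} \<times> {1..n})" "stable_grid n (grid n p pos)"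
proof -
  have finD: "finite D" by (simp add: D_def)
  define S where "S i = {j \<in> D. col j = col i \<and> (j = i \<or> p j \<prec>\<^sub>y p i)}" for i
  have finS: "finite (S i)" for i using finD by (simp add: S_def)
  have less_row: "row i < row j" if "i \<in> D" "j \<in> D" "col i = col j" "p i \<prec>\<^sub>y p j" for i j
  proof -
    have "S i \<subseteq> S j" using that by (auto simp: S_def less_y_def)
    moreover have "j \<in> S j - S i" using that by (auto simp: S_def less_y_def)
    ultimately have "card (S i) < card (S j)" by (intro psubset_card_mono finS) auto
    with that row show ?thesis by (simp add: S_def)
  qed
  have row_range: "row i \<in> {1..n}" if "i \<in> D" for i
  proof -
    have "card (S i) \<le> card {j \<in> D. col j = col i}"
      using finD by (intro card_mono) (auto simp: S_def)
    moreover have "i \<in> S i" using that by (simp add: S_def)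
    then have "0 < card (S i)" using finS by (auto simp: card_gt_0_iff)
    ultimately show ?thesis using row[OF that] card_col[OF col[OF that]] by (simp add: S_def)
  qed
  have total: "p i \<prec>\<^sub>y p j \<or> p j \<prec>\<^sub>y p i" if "i \<in> D" "j \<in> D" "i \<noteq> j" for i j
    using inj_onD[OF p _ that(1,2)] that(3)
    by (cases "p i"; cases "p j") (force simp: less_y_def)
  have inj: "inj_on pos D"
  proof (rule inj_onI, rule ccontr)
    fix i j assume "i \<in> D" "j \<in> D" "pos i = pos j" "i \<noteq> j"
    with total[of i j] less_row[of i j] less_row[of j i] show False by (auto simp: pos_def)
  qed
  have "pos ` D = {1..n} \<times> {1..n}"
  proof (rule card_subset_eq)
    show "pos ` D \<subseteq> {1..n} \<times> {1..n}" using col row_range by (auto simp: pos_def)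
    show "card (pos ` D) = card ({1..n} \<times> {1..n})"
      using inj by (simp add: card_image D_def power2_eq_square)
  qed simp
  with inj show bij: "bij_betw pos D ({1..n} \<times> {1..n})" by (simp add: bij_betw_def)
  have cell: "\<exists>i\<in>D. col i = c \<and> row i = r \<and> grid n p pos (c, r) = p i"
    if cr: "c \<in> {1..n}" "r \<in> {1..n}" for c r
  proof -
    from cr have "(c, r) \<in> pos ` D" unfolding \<open>pos ` D = _\<close> by (rule SigmaI)
    then obtain i where i: "i \<in> D" "pos i = (c, r)" by (metis imageE)
    have "the_inv_into D pos (c, r) = i" using the_inv_into_f_f[OF inj i(1)] i(2) by simp
    then have "grid n p pos (c, r) = p i" by (simp only: grid_def D_def[symmetric])
    moreover have "col i = c" "row i = r" using i(2) by (simp_all add: pos_def)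
    ultimately show ?thesis using i(1) by blast
  qed
  show "stable_grid n (grid n p pos)"
    unfolding stable_grid_def
  proof (intro conjI ballI impI)
    fix r c c' assume *: "r \<in> {1..n}" "c \<in> {1..n}" "c' \<in> {1..n}" "c < c'"
    obtain i where i: "i \<in> D" "col i = c" "grid n p pos (c, r) = p i"
      using cell[OF *(2,1)] by blast
    obtain j where j: "j \<in> D" "col j = c'" "grid n p pos (c', r) = p j"
      using cell[OF *(3,1)] by blast
    show "grid n p pos (c, r) \<prec>\<^sub>x grid n p pos (c', r)"
      using less_col[OF i(1) j(1)] *(4) unfolding i(2,3) j(2,3) by blast
  next
    fix c r r' assume *: "c \<in> {1..n}" "r \<in> {1..n}" "r' \<in> {1..n}" "r < r'"
    obtain i where i: "i \<in> D" "col i = c" "row i = r" "grid n p pos (c, r) = p i"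
      using cell[OF *(1,2)] by blast
    obtain j where j: "j \<in> D" "col j = c" "row j = r'" "grid n p pos (c, r') = p j"
      using cell[OF *(1,3)] by blast
    \<comment> \<open>Rank order is reversed into y-order by contradiction: were \<open>p j\<close>
      the y-smaller point, its row would be smaller too.\<close>
    have "\<not> row j < row i" "i \<noteq> j" using i(3) j(3) *(4) by auto
    then have "p i \<prec>\<^sub>y p j"
      using less_row[OF j(1) i(1)] total[OF i(1) j(1)] i(2) j(2) by blast
    then show "grid n p pos (c, r) \<prec>\<^sub>y grid n p pos (c, r')" unfolding i(4) j(4) .
  qed
qed

text \<open>Translates array positions into orders. A larger quotient by \<open>n\<close> forces a
  later x-position; and in the y-sorted array, the entries of the same column up to position
  \<open>q\<close> are exactly those counted by the y-rank.\<close>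

lemma sorted_placement:
  fixes n :: nat and p :: "nat \<Rightarrow> point" and a1 a2 col row :: "nat \<Rightarrow> nat"
  defines "D \<equiv> {1..n\<^sup>2}" and "pos \<equiv> (\<lambda>i. (col i, row i))"
  assumes p: "inj_on p D"
    and a1: "a1 ` {..<n\<^sup>2} = D" "monotone_on {..<n\<^sup>2} (<) (\<lambda>i j. p i \<prec>\<^sub>x p j) a1"
    and a2: "a2 ` {..<n\<^sup>2} = D" "monotone_on {..<n\<^sup>2} (<) (\<lambda>i j. p i \<prec>\<^sub>y p j) a2"
    and col: "\<And>q. q < n\<^sup>2 \<Longrightarrow> col (a1 q) = q div n + 1"
    and row: "\<And>q. q < n\<^sup>2 \<Longrightarrow> row (a2 q) = card {r. r \<le> q \<and> col (a2 r) = col (a2 q)}"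
  shows "bij_betw pos D ({1..n} \<times> {1..n})" "stable_grid n (grid n p pos)"
proof -
  have inj2: "inj_on a2 {..<n\<^sup>2}"
    by (rule eq_card_imp_inj_on) (simp_all add: a2 D_def)
  have 1: "col i \<in> {1..n}" if "i \<in> D" for i
  proof -
    from that a1(1) obtain q where "i = a1 q" "q < n\<^sup>2" by blast
    then show ?thesis
      using less_mult_imp_div_less[of q n n] col[of q] by (simp add: power2_eq_square)
  qed
  have 2: "card {i \<in> D. col i = c} \<le> n" if "c \<in> {1..n}" for c
  proof -
    have "{i \<in> D. col i = c} \<subseteq> a1 ` {(c - 1) * n..<(c - 1) * n + n}"
    proof
      fix i assume "i \<in> {i \<in> D. col i = c}"
      with a1(1) obtain q where q: "i = a1 q" "q < n\<^sup>2" "q div n = c - 1" using col by force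
      then have "0 < n" by (cases n) auto
      then have "q < q div n * n + n" "q div n * n \<le> q"
        using div_mult_mod_eq[of q n] mod_less_divisor[of n q] by linarith+
      with q show "i \<in> a1 ` {(c - 1) * n..<(c - 1) * n + n}" by simp
    qed
    then have "card {i \<in> D. col i = c} \<le> card {(c - 1) * n..<(c - 1) * n + n}"
      by (meson card_image_le card_mono finite_atLeastLessThan finite_imageI le_trans)
    then show ?thesis by simp
  qed
  have 3: "p i \<prec>\<^sub>x p j" if "i \<in> D" "j \<in> D" "col i < col j" for i j
  proof -
    from that(1,2) a1(1) obtain q r where qr: "i = a1 q" "q < n\<^sup>2" "j = a1 r" "r < n\<^sup>2" by blast
    with that(3) have "q div n < r div n" by (simp add: col)
    then have "q < r" by (meson div_le_mono leD leI)
    with qr a1(2) show ?thesis by (simp add: monotone_on_def)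
  qed
  have 4: "row i = card {j \<in> D. col j = col i \<and> (j = i \<or> p j \<prec>\<^sub>y p i)}" if "i \<in> D" for i
  proof -
    from that a2(1) obtain q where q: "i = a2 q" "q < n\<^sup>2" by blast
    \<comment> \<open>Strict monotonicity of \<open>a2\<close> identifies the reflexive y-order with
      the order of positions.\<close>
    have le: "a2 r = a2 q \<or> p (a2 r) \<prec>\<^sub>y p (a2 q) \<longleftrightarrow> r \<le> q" if "r < n\<^sup>2" for r
    proof (cases r q rule: linorder_cases)
      case less
      then show ?thesis using that q a2(2) by (simp add: monotone_on_def)
    next
      case greater
      then have "p (a2 q) \<prec>\<^sub>y p (a2 r)" using that q a2(2) by (simp add: monotone_on_def)
      then show ?thesis using greater by (auto simp: less_y_def)
    qed auto
    have "{j \<in> D. col j = col i \<and> (j = i \<or> p j \<prec>\<^sub>y p i)} =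
        a2 ` {r. r \<le> q \<and> col (a2 r) = col (a2 q)}"
    proof -
      have "{j \<in> D. col j = col i \<and> (j = i \<or> p j \<prec>\<^sub>y p i)} =
          a2 ` {r. (r < n\<^sup>2 \<and> (a2 r = i \<or> p (a2 r) \<prec>\<^sub>y p i)) \<and> col (a2 r) = col i}"
        unfolding a2(1)[symmetric] by blast
      also have "{r. (r < n\<^sup>2 \<and> (a2 r = i \<or> p (a2 r) \<prec>\<^sub>y p i)) \<and> col (a2 r) = col i} =
          {r. r \<le> q \<and> col (a2 r) = col (a2 q)}"
        unfolding q(1) using le q(2) by (intro Collect_cong conj_cong refl) (metis le_less_trans)
      finally show ?thesis .
    qed
    moreover have "inj_on a2 {r. r \<le> q \<and> col (a2 r) = col (a2 q)}"
      using q by (intro inj_on_subset[OF inj2]) auto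
    ultimately show ?thesis by (simp add: card_image q row)
  qed
  show "bij_betw pos D ({1..n} \<times> {1..n})" "stable_grid n (grid n p pos)"
    unfolding pos_def
    by (rule rank_placement[of p n col row, folded D_def]; fact p 1 2 3 4)+
qed

subsection \<open>Computing the placement\<close>

text \<open>Natural expressions have no multiplication; \<open>n\<close> additions cost time linear
  in \<open>n\<close>, which is at most linear in \<open>N\<close>.\<close>

definition square :: com where
  "square = Seq (NAssign ''N'' (NConst 0)) (Seq (NAssign ''k'' (NConst 0))
    (While (NLess (V ''k'') (V ''n''))
      (Seq (NAssign ''N'' (NAdd (V ''N'') (V ''n''))) (incr ''k''))))"

lemma wp_square:
  "wp square (\<lambda>t s. t \<le> 12 * nvar s0 ''n'' + 8 \<and> nvar s ''N'' = (nvar s0 ''n'')\<^sup>2 \<and>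
    frame {''N'', ''k''} {} s0 s) s0"
proof -
  define J where "J k s \<longleftrightarrow> nvar s ''k'' = k \<and> nvar s ''N'' = k * nvar s0 ''n'' \<and>
    frame {''N'', ''k''} {} s0 s" for k s
  show ?thesis
    unfolding square_def wp_Seq wp_atomic
    by (rule wp_mono, rule wp_count_up[where J = J and M = "nvar s0 ''n''" and C = 8])
       (auto simp: J_def frame_def power2_eq_square)
qed

text \<open>Array positions count from 0, points from 1.\<close>

definition enumerate_into :: "string \<Rightarrow> com" where
  "enumerate_into a = Seq (NAssign ''k'' (NConst 0)) (While (NLess (V ''k'') (V ''N''))
    (Seq (NWrite a (V ''k'') (NAdd (V ''k'') (NConst 1))) (incr ''k'')))"

lemma wp_enumerate_into:
  "wp (enumerate_into a) (\<lambda>t s. t \<le> 13 * nvar s0 ''N'' + 6 \<and>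
    (\<forall>q<nvar s0 ''N''. narr s a q = q + 1) \<and> frame {''k''} {a} s0 s) s0"
proof -
  define J where "J k s \<longleftrightarrow> nvar s ''k'' = k \<and> (\<forall>q<k. narr s a q = q + 1) \<and>
    frame {''k''} {a} s0 s" for k s
  show ?thesis
    unfolding enumerate_into_def wp_Seq wp_atomic
    by (rule wp_mono, rule wp_count_up[where J = J and M = "nvar s0 ''N''" and C = 9])
       (auto simp: J_def frame_def less_Suc_eq)
qed

text \<open>\<open>c\<close> and \<open>m\<close> replace division by \<open>n\<close>:
  \<open>c - 1\<close> is the running quotient and \<open>m\<close> the number of points already in
  column \<open>c\<close>.\<close>

definition assign_columns :: "string \<Rightarrow> com" where
  "assign_columns a = Seq (NAssign ''k'' (NConst 0)) (Seq (NAssign ''c'' (NConst 1))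
    (Seq (NAssign ''m'' (NConst 0)) (While (NLess (V ''k'') (V ''N''))
    (Seq (If (NLess (V ''m'') (V ''n'')) Skip (Seq (incr ''c'') (NAssign ''m'' (NConst 0))))
    (Seq (NWrite ''column'' (NRead a (V ''k'')) (V ''c''))
    (Seq (incr ''m'') (incr ''k'')))))))"

lemma wp_assign_columns:
  fixes s0 :: state and a :: string
  defines "n \<equiv> nvar s0 ''n''" and "N \<equiv> nvar s0 ''N''" and "A \<equiv> narr s0 a"
  assumes "N = n\<^sup>2" and a: "a \<noteq> ''column''" and inj: "inj_on A {..<N}"
  shows "wp (assign_columns a) (\<lambda>t s. t \<le> 40 * N + 10 \<and>
    (\<forall>q<N. narr s ''column'' (A q) = q div n + 1) \<and>
    frame {''k'', ''c'', ''m''} {''column''} s0 s) s0"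
proof -
  \<comment> \<open>The bound on \<open>m\<close> is not strict: a full column is left only at the
    start of the next iteration, so \<open>m = n\<close> occurs between iterations.\<close>
  define J where "J k s \<longleftrightarrow> nvar s ''k'' = k \<and>
    (\<exists>d. nvar s ''c'' = Suc d \<and> k = d * n + nvar s ''m'') \<and> nvar s ''m'' \<le> n \<and>
    (\<forall>q<k. narr s ''column'' (A q) = q div n + 1) \<and>
    frame {''k'', ''c'', ''m''} {''column''} s0 s" for k s
  show ?thesis
    unfolding assign_columns_def wp_Seq[of "NAssign _ _"] wp_atomic
  proof (rule wp_mono, rule wp_count_up[where J = J and M = N and C = 30])
    fix k s assume J: "J k s" "k < N"
    with \<open>N = n\<^sup>2\<close> have "0 < n" by (cases n) simp_all
    from J have F: "narr s a = A" "nvar s ''n'' = n" "nvar s ''k'' = k"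
      using a by (auto simp: J_def frame_def A_def n_def)
    \<comment> \<open>Since \<open>A\<close> has no repetitions, the write for the current point
      leaves the columns of earlier points intact.\<close>
    have upd: "((narr s ''column'')(A k := v)) (A q) = (if q = k then v else narr s ''column'' (A q))"
      if "q < Suc k" for q v
      using inj_onD[OF inj, of q k] that J(2) by auto
    from J obtain d where d: "nvar s ''c'' = Suc d" "k = d * n + nvar s ''m''" "nvar s ''m'' \<le> n"
      by (auto simp: J_def)
    have fr: "frame {''k'', ''c'', ''m''} {''column''} s0 s"
      and old: "\<forall>q<k. narr s ''column'' (A q) = q div n + 1" using J by (simp_all add: J_def)
    show "wp (Seq (If (NLess (V ''m'') (V ''n'')) Skip (Seq (incr ''c'') (NAssign ''m'' (NConst 0))))
      (Seq (NWrite ''column'' (NRead a (V ''k'')) (V ''c''))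
      (Seq (incr ''m'') (incr ''k'')))) (\<lambda>u s'. u \<le> 30 \<and> J (Suc k) s') s"
    proof (cases "nvar s ''m'' < n")
      case True
      then have "k div n = d" using d(2) by simp
      with True d fr old F upd show ?thesis by (auto simp: J_def frame_def)
    next
      case False
      then have "k = Suc d * n" "nvar s ''m'' = n" using d by simp_all
      then have "k div n = Suc d" using \<open>0 < n\<close> by simp
      with False d fr old F upd \<open>0 < n\<close> \<open>k = Suc d * n\<close> show ?thesis
        by (auto simp: J_def frame_def intro!: exI[of _ "Suc d"])
    qed
  qed (auto simp: J_def frame_def n_def N_def)
qed

definition assign_rows :: "string \<Rightarrow> com" where
  "assign_rows a = Seq (NAssign ''k'' (NConst 0)) (While (NLess (V ''k'') (V ''N''))
    (Seq (NAssign ''c'' (NRead ''column'' (NRead a (V ''k''))))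
    (Seq (NWrite ''count'' (V ''c'') (NAdd (NRead ''count'' (V ''c'')) (NConst 1)))
    (Seq (NWrite ''row'' (NRead a (V ''k'')) (NRead ''count'' (V ''c'')))
    (incr ''k'')))))"

text \<open>A counter holds the number of points of its column seen so far. It is increased before
  being read, so the point counts itself; the counters start at the zeros of the initial
  memory.\<close>

lemma wp_assign_rows:
  fixes s0 :: state and a :: string
  defines "N \<equiv> nvar s0 ''N''" and "A \<equiv> narr s0 a" and "col \<equiv> narr s0 ''column''"
  assumes a: "a \<noteq> ''count''" "a \<noteq> ''row''" and inj: "inj_on A {..<N}"
    and zero: "narr s0 ''count'' = (\<lambda>_. 0)"
  shows "wp (assign_rows a) (\<lambda>t s. t \<le> 40 * N + 10 \<and>
    (\<forall>q<N. narr s ''row'' (A q) = card {r. r \<le> q \<and> col (A r) = col (A q)}) \<and>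
    frame {''k'', ''c''} {''count'', ''row''} s0 s) s0"
proof -
  define J where "J k s \<longleftrightarrow> nvar s ''k'' = k \<and>
    (\<forall>c. narr s ''count'' c = card {r. r < k \<and> col (A r) = c}) \<and>
    (\<forall>q<k. narr s ''row'' (A q) = card {r. r \<le> q \<and> col (A r) = col (A q)}) \<and>
    frame {''k'', ''c''} {''count'', ''row''} s0 s" for k s
  show ?thesis
    unfolding assign_rows_def wp_Seq[of "NAssign _ _"] wp_atomic
  proof (rule wp_mono, rule wp_count_up[where J = J and M = N and C = 30])
    fix k s assume J: "J k s" "k < N"
    then have F: "narr s a = A" "narr s ''column'' = col" "nvar s ''k'' = k"
      using a by (auto simp: J_def frame_def A_def col_def)
    have upd: "((narr s ''row'')(A k := v)) (A q) = (if q = k then v else narr s ''row'' (A q))"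
      if "q < Suc k" for q v
      using inj_onD[OF inj, of q k] that J(2) by auto
    have fr: "frame {''k'', ''c''} {''count'', ''row''} s0 s"
      and count: "\<forall>c. narr s ''count'' c = card {r. r < k \<and> col (A r) = c}"
      and old: "\<forall>q<k. narr s ''row'' (A q) = card {r. r \<le> q \<and> col (A r) = col (A q)}"
      using J by (simp_all add: J_def)
    have "{r. r < Suc k \<and> col (A r) = c} =
        (if col (A k) = c then insert k {r. r < k \<and> col (A r) = c} else {r. r < k \<and> col (A r) = c})" for c
      by (auto simp: less_Suc_eq)
    then have card: "card {r. r < Suc k \<and> col (A r) = c} =
        (if col (A k) = c then Suc (card {r. r < k \<and> col (A r) = c})
         else card {r. r < k \<and> col (A r) = c})" for c
      by simp
    then show "wp (Seq (NAssign ''c'' (NRead ''column'' (NRead a (V ''k''))))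
      (Seq (NWrite ''count'' (V ''c'') (NAdd (NRead ''count'' (V ''c'')) (NConst 1)))
      (Seq (NWrite ''row'' (NRead a (V ''k'')) (NRead ''count'' (V ''c'')))
      (incr ''k'')))) (\<lambda>u s'. u \<le> 30 \<and> J (Suc k) s') s"
      using fr count old F upd a card[of "col (A k)"] by (auto simp: J_def frame_def less_Suc_eq_le)
  qed (auto simp: J_def frame_def N_def zero)
qed

lemma wp_SeqI:
  assumes "wp c Q s" "\<And>t s'. Q t s' \<Longrightarrow> wp d (\<lambda>u. R (t + u)) s'"
  shows "wp (Seq c d) R s"
  using assms by (simp add: wp_mono)

text \<open>\<open>''column''\<close> is indexed by points, not positions, so it survives re-sorting
  the array \<open>''a''\<close>. The second sort may start from the x-sorted array, since merge
  sort accepts any permutation.\<close>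

definition place_points :: com where
  "place_points = Seq square (Seq (enumerate_into ''a'')
    (Seq (merge_sort ''x'' ''y'' ''a'' ''b'') (Seq (assign_columns ''a'')
    (Seq (merge_sort ''y'' ''x'' ''a'' ''b'') (assign_rows ''a'')))))"

lemma wp_place_points:
  assumes p: "inj_on p {1..n\<^sup>2}" and L: "n\<^sup>2 \<le> 4 ^ L"
  shows "wp place_points (\<lambda>t s. t \<le> 500 * (n\<^sup>2 + 1) * (L + 1) \<and>
    bij_betw (output_placement s) {1..n\<^sup>2} ({1..n} \<times> {1..n}) \<and>
    stable_grid n (grid n p (output_placement s))) (input_state n p)"
proof -
  define N where "N = n\<^sup>2"
  define D where "D = {1..N}"
  define s0 where "s0 = input_state n p"
  define S where "S = (240 * N + 50) * L + 6"
  define X Y where "X = rarr s0 ''x''" and "Y = rarr s0 ''y''"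
  have s0: "nvar s0 ''n'' = n" "narr s0 = (\<lambda>_ _. 0)"
    by (simp_all add: s0_def input_state_def)
  \<comment> \<open>Restricted to \<open>D\<close>, since the coordinate arrays hold zeros
    elsewhere.\<close>
  have bx: "before X Y i j \<longleftrightarrow> p i \<prec>\<^sub>x p j" and by_y: "before Y X i j \<longleftrightarrow> p i \<prec>\<^sub>y p j"
    if "i \<in> D" "j \<in> D" for i j
    using that
    by (simp_all add: X_def Y_def s0_def input_state_def before_def less_x_def less_y_def D_def N_def)
  have inj_p: "p i \<noteq> p j" if "i \<in> D" "j \<in> D" "i \<noteq> j" for i j
    using inj_onD[OF p] that by (auto simp: D_def N_def)
  have total: "totalp_on D (before X Y)" "totalp_on D (before Y X)"
    using inj_p by (auto simp: totalp_on_def bx by_y less_x_def less_y_def prod_eq_iff)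
      (meson linorder_neqE_linordered_idom)+
  have inj: "inj_on A {..<N}" if "A ` {..<N} = D" for A :: "nat \<Rightarrow> nat"
    using that by (intro eq_card_imp_inj_on) (simp_all add: D_def)
  have mem: "A q \<in> D" if "A ` {..<N} = D" "q < N" for A :: "nat \<Rightarrow> nat" and q
    using that by auto
  \<comment> \<open>What every stage before \<open>assign_rows\<close> preserves: the sizes, the
    sort keys and the untouched counters.\<close>
  define K where "K s \<longleftrightarrow> nvar s ''n'' = n \<and> nvar s ''N'' = N \<and> rarr s ''x'' = X \<and>
    rarr s ''y'' = Y \<and> narr s ''count'' = (\<lambda>_. 0)"
    for s :: state
  have K_frame: "K s'" if "K s" "frame U A s s'" "''n'' \<notin> U" "''N'' \<notin> U" "''count'' \<notin> A" for s s' U A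
    using that by (simp add: K_def frame_def)
  show ?thesis
    unfolding place_points_def s0_def[symmetric] N_def[symmetric]
  proof (rule wp_SeqI[OF wp_square], elim conjE)
    fix t1 s1
    assume t1: "t1 \<le> 12 * nvar s0 ''n'' + 8" and "nvar s1 ''N'' = (nvar s0 ''n'')\<^sup>2"
      and "frame {''N'', ''k''} {} s0 s1"
    then have K1: "K s1" by (simp add: K_def frame_def s0 N_def X_def Y_def)
    then have N1: "nvar s1 ''N'' = N" by (simp add: K_def)
    show "wp (Seq (enumerate_into ''a'')
       (Seq (merge_sort ''x'' ''y'' ''a'' ''b'') (Seq (assign_columns ''a'')
       (Seq (merge_sort ''y'' ''x'' ''a'' ''b'') (assign_rows ''a'')))))
      (\<lambda>u s. t1 + u \<le> 500 * (N + 1) * (L + 1) \<and>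
        bij_betw (output_placement s) {1..N} ({1..n} \<times> {1..n}) \<and>
        stable_grid n (grid n p (output_placement s))) s1"
    proof (rule wp_SeqI[OF wp_enumerate_into[of "''a''" s1, unfolded N1]], elim conjE)
      fix t2 s2
      assume t2: "t2 \<le> 13 * N + 6" and a: "\<forall>q<N. narr s2 ''a'' q = q + 1"
        and fr: "frame {''k''} {''a''} s1 s2"
      have K2: "K s2" using K_frame[OF K1 fr] by simp
      then have F2: "rarr s2 ''x'' = X" "rarr s2 ''y'' = Y" "nvar s2 ''N'' = N" by (simp_all add: K_def)
      have "narr s2 ''a'' ` {..<N} = Suc ` {..<N}" using a by (intro image_cong) simp_all
      then have im2: "narr s2 ''a'' ` {..<N} = D" by (simp add: D_def image_Suc_lessThan)
      show "wp (Seq (merge_sort ''x'' ''y'' ''a'' ''b'') (Seq (assign_columns ''a'')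
         (Seq (merge_sort ''y'' ''x'' ''a'' ''b'') (assign_rows ''a''))))
        (\<lambda>u s. t1 + (t2 + u) \<le> 500 * (N + 1) * (L + 1) \<and>
          bij_betw (output_placement s) {1..N} ({1..n} \<times> {1..n}) \<and>
          stable_grid n (grid n p (output_placement s))) s2"
      proof (rule wp_SeqI[OF wp_merge_sort[of "''a''" "''b''" s2 "''x''" "''y''" L, unfolded F2 im2]], goal_cases)
        case (5 t3 s3)
        then have t3: "t3 \<le> S" and im3: "narr s3 ''a'' ` {..<N} = D"
          and mono3: "monotone_on {..<N} (<) (before X Y) (narr s3 ''a'')"
          and fr: "frame (insert ''w'' merge_vars) {''a'', ''b''} s2 s3" by (simp_all add: S_def)
        have K3: "K s3" using K_frame[OF K2 fr] by (simp add: merge_vars_def)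
        then have F3: "nvar s3 ''N'' = N" "nvar s3 ''n'' = n" by (simp_all add: K_def)
        show ?case
        proof (rule wp_SeqI[OF wp_assign_columns[of s3 "''a''", unfolded F3]], goal_cases)
          case (4 t4 s4)
          then have t4: "t4 \<le> 40 * N + 10"
            and col: "\<forall>q<N. narr s4 ''column'' (narr s3 ''a'' q) = q div n + 1"
            and fr: "frame {''k'', ''c'', ''m''} {''column''} s3 s4" by simp_all
          have K4: "K s4" using K_frame[OF K3 fr] by simp
          then have F4: "rarr s4 ''x'' = X" "rarr s4 ''y'' = Y" "nvar s4 ''N'' = N" by (simp_all add: K_def)
          have "narr s4 ''a'' = narr s3 ''a''" using fr by (simp add: frame_def)
          with im3 have im4: "narr s4 ''a'' ` {..<N} = D" by simp
          show ?case
          proof (rule wp_SeqI[OF wp_merge_sort[of "''a''" "''b''" s4 "''y''" "''x''" L, unfolded F4 im4]], goal_cases)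
            case (5 t5 s5)
            then have t5: "t5 \<le> S" and im5: "narr s5 ''a'' ` {..<N} = D"
              and mono5: "monotone_on {..<N} (<) (before Y X) (narr s5 ''a'')"
              and fr: "frame (insert ''w'' merge_vars) {''a'', ''b''} s4 s5" by (simp_all add: S_def)
            have K5: "K s5" using K_frame[OF K4 fr] by (simp add: merge_vars_def)
            then have F5: "nvar s5 ''N'' = N" "narr s5 ''count'' = (\<lambda>_. 0)" by (simp_all add: K_def)
            have col5: "narr s5 ''column'' = narr s4 ''column''" using fr by (simp add: frame_def)
            show ?case
            proof (rule wp_mono[OF wp_assign_rows[of "''a''" s5, unfolded F5 col5]], goal_cases)
              case (5 t6 s6)
              then have t6: "t6 \<le> 40 * N + 10"
                and row: "\<forall>q<N. narr s6 ''row'' (narr s5 ''a'' q) =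
                  card {r. r \<le> q \<and> narr s4 ''column'' (narr s5 ''a'' r) = narr s4 ''column'' (narr s5 ''a'' q)}"
                and fr: "frame {''k'', ''c''} {''count'', ''row''} s5 s6" by simp_all
              have col6: "narr s6 ''column'' = narr s4 ''column''"
                using fr col5 by (simp add: frame_def)
              have "monotone_on {..<N} (<) (\<lambda>i j. p i \<prec>\<^sub>x p j) (narr s3 ''a'')"
                using mono3 mem[OF im3] by (simp add: monotone_on_def bx)
              moreover have "monotone_on {..<N} (<) (\<lambda>i j. p i \<prec>\<^sub>y p j) (narr s5 ''a'')"
                using mono5 mem[OF im5] by (simp add: monotone_on_def by_y)
              ultimately have placed:
                "bij_betw (output_placement s6) {1..N} ({1..n} \<times> {1..n})"
                "stable_grid n (grid n p (output_placement s6))"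
                using sorted_placement[of p n "narr s3 ''a''" "narr s5 ''a''" "narr s4 ''column''" "narr s6 ''row''"]
                  p im3 im5 col row
                by (simp_all add: N_def D_def output_placement_def col6)
              \<comment> \<open>Turns the cost of squaring into a multiple of \<open>N\<close>: the
                linear stages sum to 12 + 13 + 40 + 40 = 105 units per point.\<close>
              have "n \<le> N" by (simp add: N_def power2_eq_square)
              with t1 t2 t3 t4 t5 t6 have
                "t1 + (t2 + (t3 + (t4 + (t5 + t6)))) \<le> 2 * ((240 * N + 50) * L) + 105 * N + 46"
                by (simp add: S_def s0)
              also have "\<dots> \<le> 500 * (N + 1) * (L + 1)" by (simp add: algebra_simps)
              finally show ?case using placed by simp
            qed (use inj[OF im5] in auto)
          qed (use inj[OF im4] total L in \<open>auto simp: N_def\<close>)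
        qed (use inj[OF im3] in \<open>auto simp: N_def\<close>)
      qed (use inj[OF im2] total L in \<open>auto simp: N_def\<close>)
    qed
  qed
qed

text \<open>Because \<open>exp 1\<close> is below 4, the rounded natural logarithm already suffices
  as number of rounds, and the bound is directly in terms of \<open>ln\<close>.\<close>

lemma le_power_nat_ceiling_ln: "N \<le> 4 ^ nat \<lceil>ln (real N)\<rceil>"
proof (cases "N = 0")
  case False
  have "real N = exp (ln (real N))" using False by simp
  also have "\<dots> \<le> exp (real (nat \<lceil>ln (real N)\<rceil>))"
    by (simp add: real_nat_ceiling_ge)
  also have "\<dots> = exp 1 ^ nat \<lceil>ln (real N)\<rceil>" by (simp add: exp_of_nat_mult[symmetric])
  also have "\<dots> \<le> 4 ^ nat \<lceil>ln (real N)\<rceil>"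
    using exp_le by (intro power_mono) auto
  finally have "real N \<le> real (4 ^ nat \<lceil>ln (real N)\<rceil>)" by simp
  then show ?thesis by (simp only: of_nat_le_iff)
qed simp

text \<open>From \<open>N = 3\<close> on, \<open>ln N\<close> is at least 1, so the rounded
  logarithm plus 1 is at most \<open>3 * ln N\<close>, and \<open>N + 1\<close> is at most
  \<open>2 * N\<close>; 3000 is 500 * 2 * 3.\<close>

lemma time_bigo:
  "(\<lambda>N. 500 * (real N + 1) * (real (nat \<lceil>ln (real N)\<rceil>) + 1)) \<in> O(\<lambda>N. real N * ln (real N))"
proof (rule bigoI[where c = 3000], rule eventually_sequentiallyI[of 3])
  fix N :: nat assume N: "3 \<le> N"
  have "exp 1 \<le> real N" using exp_le N by linarith
  then have ln: "1 \<le> ln (real N)" using N by (simp add: ln_ge_iff)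
  then have "real (nat \<lceil>ln (real N)\<rceil>) + 1 \<le> 3 * ln (real N)" by linarith
  then have "500 * (real N + 1) * (real (nat \<lceil>ln (real N)\<rceil>) + 1) \<le> 500 * (2 * real N) * (3 * ln (real N))"
    using N ln by (intro mult_mono) auto
  with ln show "norm (500 * (real N + 1) * (real (nat \<lceil>ln (real N)\<rceil>) + 1)) \<le> 3000 * norm (real N * ln (real N))"
    by simp
qed

theorem theorem1:
  shows "(\<forall>(n::nat) (p::nat \<Rightarrow> real \<times> real). inj_on p {1..n^2} \<longrightarrow>
            (\<exists>\<pi>. bij_betw \<pi> {1..n^2} ({1..n} \<times> {1..n}) \<and> stable_grid n (grid n p \<pi>))) \<and>
         (\<exists>(prog::com) (T::nat \<Rightarrow> real).
            T \<in> O(\<lambda>N. real N * ln (real N)) \<and>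
            (\<forall>(n::nat) (p::nat \<Rightarrow> real \<times> real). inj_on p {1..n^2} \<longrightarrow>
              (\<exists>t s. exec prog (input_state n p) t s \<and> real t \<le> T (n^2) \<and>
                 bij_betw (output_placement s) {1..n^2} ({1..n} \<times> {1..n}) \<and>
                 stable_grid n (grid n p (output_placement s)))))"
proof -
  \<comment> \<open>The added ones keep \<open>T\<close> positive for \<open>N\<close> equal to 0 or
    1, where \<open>N * ln N\<close> vanishes but the program still takes time.\<close>
  define T where "T N = 500 * (real N + 1) * (real (nat \<lceil>ln (real N)\<rceil>) + 1)" for N
  have run: "\<exists>t s. exec place_points (input_state n p) t s \<and> real t \<le> T (n\<^sup>2) \<and>
      bij_betw (output_placement s) {1..n\<^sup>2} ({1..n} \<times> {1..n}) \<and>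
      stable_grid n (grid n p (output_placement s))" if p: "inj_on p {1..n\<^sup>2}" for n p
  proof -
    from wp_place_points[OF p le_power_nat_ceiling_ln] obtain t s where
      *: "exec place_points (input_state n p) t s"
      "bij_betw (output_placement s) {1..n\<^sup>2} ({1..n} \<times> {1..n})"
      "stable_grid n (grid n p (output_placement s))"
      and t: "t \<le> 500 * (n\<^sup>2 + 1) * (nat \<lceil>ln (real (n\<^sup>2))\<rceil> + 1)"
      unfolding wp_def by blast
    from t have "real t \<le> real (500 * (n\<^sup>2 + 1) * (nat \<lceil>ln (real (n\<^sup>2))\<rceil> + 1))"
      by (simp only: of_nat_le_iff)
    then have "real t \<le> T (n\<^sup>2)" by (simp add: T_def algebra_simps)
    with * show ?thesis by blast
  qed
  have "T \<in> O(\<lambda>N. real N * ln (real N))"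
    using time_bigo by (simp add: T_def[abs_def])
  \<comment> \<open>The mere existence of a stable placement is witnessed by the output of the
    program.\<close>
  with run show ?thesis by blast
qed

end
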